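(* The set of 2-LEA unital qubit channels is convex: if $\mathcal{E}_1$ and $\mathcal{E}_2$ are 2-LEA unital qubit channels, then $\mu\mathcal{E}_1+(1-\mu)\mathcal{E}_2$ is also 2-LEA for all $\mu\in[0,1]$.
   Context: A qubit channel is a completely positive trace-preserving linear map on $M_2(\mathbb{C})$; it is unital if it fixes the identity $I$. A state is a positive semidefinite operator of trace one. A two-qubit channel is called entanglement-annihilating (EA) if it maps every state on $\mathbb{C}^2\otimes\mathbb{C}^2$ to a state that is separable with respect to the partition qubit 1 | qubit 2. A qubit channel $\mathcal{E}$ is called 2-locally entanglement-annihilating (2-LEA) if $\mathcal{E}\otimes\mathcal{E}$ is EA. *)

theory Defs
  imports "HOL-Analysis.Analysis"
begin

text \<open>Operators on the Hilbert space with orthonormal basis indexed by a finite type are square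
  complex matrices over that type. Operators on a tensor product are matrices over the product
  index type, the first component indexing the first tensor factor.\<close>

definition cscale :: "complex \<Rightarrow> complex^'n^'m \<Rightarrow> complex^'n^'m" where
  "cscale c A = (\<chi> i j. c * A $ i $ j)"

definition quad_form :: "complex^'n^'n \<Rightarrow> complex^'n \<Rightarrow> complex^'n \<Rightarrow> complex" where
  "quad_form A u v = (\<Sum>i\<in>UNIV. cnj (u $ i) * (A *v v) $ i)"

text \<open>Over the complex numbers, requiring the quadratic form to be real and nonnegative on all
  vectors already forces the matrix to be Hermitian.\<close>

definition psd :: "complex^'n^'n \<Rightarrow> bool" where
  "psd A \<longleftrightarrow> (\<forall>v. quad_form A v v \<in> \<real>\<^sub>\<ge>\<^sub>0)"

definition state :: "complex^'n^'n \<Rightarrow> bool" where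
  "state \<rho> \<longleftrightarrow> psd \<rho> \<and> trace \<rho> = 1"

text \<open>An operator on the tensor product of \<open>\<complex>\<^sup>N\<close> with another space is an \<open>N \<times> N\<close> array \<open>X\<close> of
  operators (its blocks), and a vector is a family \<open>v\<close> of \<open>N\<close> vectors. In this picture
  the identity on \<open>N \<times> N\<close> matrices, tensored with \<open>E\<close>, acts by applying \<open>E\<close> to each block.
  Blocks are indexed by natural numbers since \<open>N\<close> is quantified in the
  definition of complete positivity.\<close>

definition block_psd :: "nat \<Rightarrow> (nat \<Rightarrow> nat \<Rightarrow> complex^'n^'n) \<Rightarrow> bool" where
  "block_psd N X \<longleftrightarrow> (\<forall>v. (\<Sum>k<N. \<Sum>l<N. quad_form (X k l) (v k) (v l)) \<in> \<real>\<^sub>\<ge>\<^sub>0)"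

definition completely_positive :: "(complex^'n^'n \<Rightarrow> complex^'n^'n) \<Rightarrow> bool" where
  "completely_positive E \<longleftrightarrow> (\<forall>N X. block_psd N X \<longrightarrow> block_psd N (\<lambda>k l. E (X k l)))"

definition channel :: "(complex^'n^'n \<Rightarrow> complex^'n^'n) \<Rightarrow> bool" where
  "channel E \<longleftrightarrow>
     Vector_Spaces.linear cscale cscale E \<and> completely_positive E \<and> (\<forall>X. trace (E X) = trace X)"

definition unital :: "(complex^'n^'n \<Rightarrow> complex^'n^'n) \<Rightarrow> bool" where
  "unital E \<longleftrightarrow> E (mat 1) = mat 1"

definition kron :: "complex^'a^'a \<Rightarrow> complex^'b^'b \<Rightarrow> complex^('a \<times> 'b)^('a \<times> 'b)" where
  "kron A B = (\<chi> p q. A $ fst p $ fst q * B $ snd p $ snd q)"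

definition matrix_unit :: "'n \<Rightarrow> 'n \<Rightarrow> complex^'n^'n" where
  "matrix_unit i j = (\<chi> a b. if a = i \<and> b = j then 1 else 0)"

text \<open>For linear \<open>E\<close> and \<open>F\<close> this is the linear map that sends \<open>kron A B\<close> to \<open>kron (E A) (F B)\<close>,
  obtained by expanding the argument in the basis of Kronecker products of matrix units.\<close>

definition tensor_map ::
  "(complex^'a^'a \<Rightarrow> complex^'a^'a) \<Rightarrow> (complex^'b^'b \<Rightarrow> complex^'b^'b)
    \<Rightarrow> complex^('a \<times> 'b)^('a \<times> 'b) \<Rightarrow> complex^('a \<times> 'b)^('a \<times> 'b)" where
  "tensor_map E F X =
     (\<Sum>p\<in>UNIV. \<Sum>q\<in>UNIV. cscale (X $ p $ q)
        (kron (E (matrix_unit (fst p) (fst q))) (F (matrix_unit (snd p) (snd q)))))"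

definition separable :: "complex^('a::finite \<times> 'b::finite)^('a \<times> 'b) \<Rightarrow> bool" where
  "separable \<rho> \<longleftrightarrow> \<rho> \<in> convex hull {kron A B | A B. state A \<and> state B}"

definition entanglement_annihilating ::
  "(complex^('a::finite \<times> 'b::finite)^('a \<times> 'b) \<Rightarrow> complex^('a \<times> 'b)^('a \<times> 'b)) \<Rightarrow> bool" where
  "entanglement_annihilating \<Phi> \<longleftrightarrow> channel \<Phi> \<and> (\<forall>\<rho>. state \<rho> \<longrightarrow> separable (\<Phi> \<rho>))"

definition two_LEA :: "(complex^2^2 \<Rightarrow> complex^2^2) \<Rightarrow> bool" where
  "two_LEA E \<longleftrightarrow> channel E \<and> entanglement_annihilating (tensor_map E E)"

definition mixture ::
  "real \<Rightarrow> (complex^'n^'n \<Rightarrow> complex^'n^'n) \<Rightarrow> (complex^'n^'n \<Rightarrow> complex^'n^'n)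
    \<Rightarrow> complex^'n^'n \<Rightarrow> complex^'n^'n" where
  "mixture \<mu> E F = (\<lambda>X. \<mu> *\<^sub>R E X + (1 - \<mu>) *\<^sub>R F X)"

lemma vector_space_cscale: "vector_space (cscale :: complex \<Rightarrow> complex^'n^'m \<Rightarrow> _)"
  by unfold_locales (simp_all add: cscale_def vec_eq_iff algebra_simps)

lemma linear_cscale_iff:
  "Vector_Spaces.linear cscale cscale (E :: complex^'n^'n \<Rightarrow> complex^'m^'m) \<longleftrightarrow>
     (\<forall>X Y. E (X + Y) = E X + E Y) \<and> (\<forall>c X. E (cscale c X) = cscale c (E X))"
  by (auto simp: Vector_Spaces.linear_def module_hom_def module_hom_axioms_def
      vector_space_cscale vector_space_cscale[folded module_iff_vector_space])

lemma sum_matrix_unit: "(\<Sum>i\<in>UNIV. \<Sum>j\<in>UNIV. cscale (A $ i $ j) (matrix_unit i j)) = A"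
proof -
  have *: "A $ i $ j * (if a = i \<and> b = j then 1 else 0) =
      (if a = i then if b = j then A $ i $ j else 0 else 0)" for a b i j
    by simp
  have "(\<Sum>i\<in>UNIV. \<Sum>j\<in>UNIV. if a = i then if b = j then A $ i $ j else 0 else 0) = A $ a $ b" for a b
    by (subst sum.swap) simp
  then show ?thesis
    by (simp only: vec_eq_iff sum_component cscale_def matrix_unit_def vec_lambda_beta * simp_thms)
qed

lemma linear_sum_matrix_unit:
  assumes "Vector_Spaces.linear cscale cscale (E :: complex^'n^'n \<Rightarrow> complex^'m^'m)"
  shows "E A = (\<Sum>i\<in>UNIV. \<Sum>j\<in>UNIV. cscale (A $ i $ j) (E (matrix_unit i j)))"
proof -
  interpret Vector_Spaces.linear cscale cscale E by fact
  have "E A = E (\<Sum>i\<in>UNIV. \<Sum>j\<in>UNIV. cscale (A $ i $ j) (matrix_unit i j))"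
    by (simp only: sum_matrix_unit)
  then show ?thesis by (simp only: sum scale)
qed

lemma tensor_map_kron:
  assumes "Vector_Spaces.linear cscale cscale E" "Vector_Spaces.linear cscale cscale F"
  shows "tensor_map E F (kron A B) = kron (E A) (F B)"
proof -
  have "tensor_map E F (kron A B) $ x $ y = kron (E A) (F B) $ x $ y" for x y
  proof -
    let ?e = "\<lambda>i j. A $ i $ j * E (matrix_unit i j) $ fst x $ fst y"
    let ?f = "\<lambda>k l. B $ k $ l * F (matrix_unit k l) $ snd x $ snd y"
    have "tensor_map E F (kron A B) $ x $ y =
        (\<Sum>p\<in>UNIV. \<Sum>q\<in>UNIV. ?e (fst p) (fst q) * ?f (snd p) (snd q))"
      by (simp add: tensor_map_def kron_def cscale_def sum_component mult_ac)
    also have "\<dots> = (\<Sum>i\<in>UNIV. \<Sum>k\<in>UNIV. \<Sum>j\<in>UNIV. \<Sum>l\<in>UNIV. ?e i j * ?f k l)"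
      by (simp add: UNIV_Times_UNIV[symmetric] sum.cartesian_product' del: UNIV_Times_UNIV)
    also have "\<dots> = (\<Sum>i\<in>UNIV. \<Sum>j\<in>UNIV. ?e i j) * (\<Sum>k\<in>UNIV. \<Sum>l\<in>UNIV. ?f k l)"
      by (simp only: sum_product)
    also have "\<dots> = E A $ fst x $ fst y * F B $ snd x $ snd y"
      by (simp add: linear_sum_matrix_unit[OF assms(1), of A] linear_sum_matrix_unit[OF assms(2), of B]
          sum_component cscale_def)
    finally show ?thesis by (simp add: kron_def)
  qed
  then show ?thesis by (simp add: vec_eq_iff)
qed

lemma linear_tensor_map: "Vector_Spaces.linear cscale cscale (tensor_map E F)"
  unfolding linear_cscale_iff
  by (simp add: tensor_map_def cscale_def vec_eq_iff sum_component sum.distrib sum_distrib_left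
      algebra_simps)

end

theory Submission
  imports Defs
begin

text \<open>For an orthonormal basis of \<open>\<complex>\<^sup>2\<close> let \<open>\<sigma>\<^sub>1, \<sigma>\<^sub>2, \<sigma>\<^sub>3\<close> be its Pauli operators. A unital qubit
  channel \<open>E\<close> is 2-LEA iff \<open>\<Sum>\<parallel>E \<sigma>\<^sub>i\<parallel>\<^sup>2 \<le> 2\<close> (Hilbert-Schmidt norm) for every basis, and this
  bound is convex in \<open>E\<close>.

  Necessity: \<open>E \<otimes> E\<close> sends the singlet to \<open>(I - \<Sum> E \<sigma>\<^sub>i \<otimes> E \<sigma>\<^sub>i) / 4\<close>, and the swap operator has
  nonnegative expectation in separable states.

  Sufficiency: it is enough to treat pure inputs, which in Schmidt bases read
  \<open>(n I \<otimes> I + c (\<sigma>\<^sub>3 \<otimes> I + I \<otimes> \<tau>\<^sub>3) + n \<sigma>\<^sub>3 \<otimes> \<tau>\<^sub>3 + s (\<sigma>\<^sub>1 \<otimes> \<tau>\<^sub>1 - \<sigma>\<^sub>2 \<otimes> \<tau>\<^sub>2)) / 4\<close> with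
  \<open>c\<^sup>2 + s\<^sup>2 = n\<^sup>2\<close>. With \<open>u\<^sub>i\<close>, \<open>v\<^sub>i\<close> the Bloch lengths of \<open>E \<sigma>\<^sub>i\<close>, \<open>E \<tau>\<^sub>i\<close>, the terms in \<open>s\<close> become
  separable after adding \<open>s (u\<^sub>1 v\<^sub>1 + u\<^sub>2 v\<^sub>2) I \<otimes> I / 4\<close>, and the remainder is a combination of four
  products of eigenstates of \<open>E \<sigma>\<^sub>3\<close> and \<open>E \<tau>\<^sub>3\<close> whose coefficients are nonnegative by the
  Cauchy-Schwarz inequality.\<close>

section \<open>Positive semidefinite matrices\<close>

lemma quad_form_alt: "quad_form A u v = (\<Sum>i\<in>UNIV. \<Sum>j\<in>UNIV. cnj (u $ i) * A $ i $ j * v $ j)"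
  by (simp add: quad_form_def matrix_vector_mult_def sum_distrib_left mult.assoc)

definition outer :: "complex^'n \<Rightarrow> complex^'m \<Rightarrow> complex^'m^'n" where
  "outer u v = (\<chi> i j. u $ i * cnj (v $ j))"

lemma quad_form_add: "quad_form (A + B) u v = quad_form A u v + quad_form B u v"
  by (simp add: quad_form_alt algebra_simps sum.distrib)

lemma quad_form_diff: "quad_form (A - B) u v = quad_form A u v - quad_form B u v"
  by (simp add: quad_form_alt algebra_simps sum_subtractf)

lemma quad_form_scaleR: "quad_form (r *\<^sub>R A) u v = of_real r * quad_form A u v"
  by (simp add: quad_form_alt sum_distrib_left scaleR_conv_of_real[where 'a=complex] algebra_simps)

lemma nonneg_Reals_scaleR:
  "0 \<le> r \<Longrightarrow> z \<in> \<real>\<^sub>\<ge>\<^sub>0 \<Longrightarrow> of_real r * (z::complex) \<in> \<real>\<^sub>\<ge>\<^sub>0"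
  by (simp add: nonneg_Reals_mult_I)

lemma psd_scaleR: "0 \<le> r \<Longrightarrow> psd A \<Longrightarrow> psd (r *\<^sub>R A)"
  by (simp add: psd_def quad_form_scaleR nonneg_Reals_scaleR)

lemma quad_form_outer: "quad_form (outer u u) v v = of_real ((cmod (\<Sum>i\<in>UNIV. cnj (u $ i) * v $ i))\<^sup>2)"
proof -
  have "quad_form (outer u u) v v = (\<Sum>i\<in>UNIV. cnj (v $ i) * u $ i) * (\<Sum>i\<in>UNIV. cnj (u $ i) * v $ i)"
    by (simp add: quad_form_alt outer_def sum_product algebra_simps)
  also have "(\<Sum>i\<in>UNIV. cnj (v $ i) * u $ i) = cnj (\<Sum>i\<in>UNIV. cnj (u $ i) * v $ i)"
    by (simp add: mult.commute)
  finally show ?thesis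
    by (simp only: complex_norm_square mult.commute)
qed

lemma psd_outer: "psd (outer u u)"
  by (simp add: psd_def quad_form_outer)

lemma quad_form_axis_axis: "quad_form A (axis i a) (axis j b) = cnj a * A $ i $ j * b"
proof -
  have "quad_form A (axis i a) (axis j b) =
    (\<Sum>k\<in>UNIV. \<Sum>l\<in>UNIV. if k = i then if l = j then cnj a * A $ i $ j * b else 0 else 0)"
    unfolding quad_form_alt by (intro sum.cong refl) (auto simp: axis_def)
  also have "\<dots> = cnj a * A $ i $ j * b"
    by (subst sum.swap) simp
  finally show ?thesis .
qed

lemma quad_form_add_left: "quad_form A (u + u') v = quad_form A u v + quad_form A u' v"
  by (simp add: quad_form_alt algebra_simps sum.distrib)

lemma quad_form_add_right: "quad_form A u (v + v') = quad_form A u v + quad_form A u v'"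
  by (simp add: quad_form_alt algebra_simps sum.distrib)

lemma psd_diag: "psd A \<Longrightarrow> A $ i $ i \<in> \<real>\<^sub>\<ge>\<^sub>0"
  using quad_form_axis_axis[of A i 1 i 1] by (metis complex_cnj_one mult_1 mult_1_right psd_def)

text \<open>Polarization: reality of the form at \<open>e_i + e_j\<close> and at
  \<open>e_i + \<i> e_j\<close> gives the imaginary and the real part of the claim.\<close>

lemma psd_hermitian:
  assumes "psd A"
  shows "A $ j $ i = cnj (A $ i $ j)"
proof -
  have r: "quad_form A v v \<in> \<real>\<^sub>\<ge>\<^sub>0" for v
    using assms by (simp add: psd_def)
  have "Im (quad_form A v v) = 0" for v
    using r[of v] by (simp add: complex_nonneg_Reals_iff)
  from this[of "axis i 1 + axis j 1"] this[of "axis i 1 + axis j \<i>"] this[of "axis i 1"] this[of "axis j 1"]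
  show ?thesis
    by (simp add: quad_form_add_left quad_form_add_right quad_form_axis_axis complex_eq_iff)
qed

lemma psd_diag_zero:
  assumes "psd A" and "A $ i $ i = 0"
  shows "A $ i $ j = 0"
proof (rule ccontr)
  assume nz: "A $ i $ j \<noteq> 0"
  define z where "z = A $ i $ j"
  define d where "d = Re (A $ j $ j)"
  have herm: "A $ j $ i = cnj z" unfolding z_def by (rule psd_hermitian[OF assms(1)])
  have d: "A $ j $ j = of_real d" "d \<ge> 0" using psd_diag[OF assms(1), of j]
    by (auto simp: d_def complex_nonneg_Reals_iff complex_eq_iff)
  have q: "Re (quad_form A v v) \<ge> 0" for v
    using assms(1) by (auto simp: psd_def complex_nonneg_Reals_iff)
  \<comment> \<open>With \<open>t |z|^2 = d + 1\<close> the form at \<open>- t z e_i + e_j\<close>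
    equals \<open>d - 2 (d + 1)\<close>, which is negative.\<close>
  define t where "t = (d + 1) / (cmod z)\<^sup>2"
  have "quad_form A (axis i (- (of_real t * z)) + axis j 1) (axis i (- (of_real t * z)) + axis j 1)
      = of_real d - of_real (2 * t) * (z * cnj z)"
    by (simp add: quad_form_add_left quad_form_add_right quad_form_axis_axis assms(2) herm d
        z_def[symmetric] algebra_simps)
  also have "\<dots> = of_real (d - 2 * t * (cmod z)\<^sup>2)"
    by (simp add: complex_norm_square[symmetric])
  finally have "quad_form A (axis i (- (of_real t * z)) + axis j 1) (axis i (- (of_real t * z)) + axis j 1)
      = of_real (d - 2 * t * (cmod z)\<^sup>2)" .
  with q have "0 \<le> d - 2 * t * (cmod z)\<^sup>2" by (metis Re_complex_of_real)
  moreover have "t * (cmod z)\<^sup>2 = d + 1" using nz by (simp add: t_def z_def)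
  ultimately show False using d(2) by simp
qed

text \<open>Completing the square: the quadratic form of \<open>A - v v\<^sup>*\<close> at \<open>w\<close> is that of \<open>A\<close> at
  \<open>w\<close> minus its \<open>A\<close>-orthogonal projection onto the \<open>k\<close>-th axis.\<close>

lemma psd_schur_complement:
  assumes "psd A" and "A $ k $ k \<noteq> 0"
  obtains v where "psd (A - outer v v)" "(A - outer v v) $ k $ k = 0"
    "\<And>i. A $ i $ i = 0 \<Longrightarrow> (A - outer v v) $ i $ i = 0"
proof -
  define d where "d = Re (A $ k $ k)"
  have d: "A $ k $ k = of_real d" "d > 0"
    using psd_diag[OF assms(1), of k] assms(2)
    by (auto simp: d_def complex_nonneg_Reals_iff complex_eq_iff less_le)
  \<comment> \<open>The \<open>k\<close>-th column over the square root of the pivot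
    \<open>d\<close>, so that \<open>outer v v\<close> and \<open>A\<close> agree in row and column
    \<open>k\<close>.\<close>
  define v :: "complex^'a" where "v = (\<chi> i. A $ i $ k / of_real (sqrt d))"
  have dd: "complex_of_real (sqrt d) * complex_of_real (sqrt d) = of_real d"
    using d(2) by (metis less_eq_real_def of_real_mult real_sqrt_mult_self abs_of_pos)
  have sd: "complex_of_real (sqrt d) \<noteq> 0" using d by simp
  have vA: "v $ i * cnj (v $ j) = A $ i $ k * A $ k $ j / of_real d" for i j
    by (simp add: v_def psd_hermitian[OF assms(1), of k j] dd)
  have "quad_form (A - outer v v) w w \<in> \<real>\<^sub>\<ge>\<^sub>0" for w
  proof -
    define s where "s = (\<Sum>j\<in>UNIV. A $ k $ j * w $ j)"
    define u where "u = w + axis k (- s / of_real d)"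
    have cs: "(\<Sum>i\<in>UNIV. cnj (w $ i) * A $ i $ k) = cnj s"
      unfolding s_def cnj_sum
      by (intro sum.cong refl) (simp add: psd_hermitian[OF assms(1), of _ k])
    have wk: "quad_form A w (axis k b) = cnj s * b" for b
      unfolding quad_form_alt cs[symmetric] sum_distrib_right
      by (intro sum.cong refl)
        (simp add: axis_def if_distrib[of "\<lambda>x. _ * x"] cong: if_cong)
    have kw: "quad_form A (axis k b) w = cnj b * s" for b
      unfolding quad_form_alt s_def sum_distrib_left
      by (subst sum.swap, intro sum.cong refl)
        (simp add: axis_def if_distrib[of cnj] if_distrib[of "\<lambda>x. x * _"] mult.assoc cong: if_cong)
    have q: "quad_form (outer v v) w w = cnj s * s / of_real d"
      unfolding quad_form_alt outer_def cs[symmetric] unfolding s_def sum_product sum_divide_distrib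
      by (intro sum.cong refl) (simp add: vA)
    have "quad_form A u u = quad_form A w w - cnj s * s / of_real d"
      unfolding u_def quad_form_add_left quad_form_add_right wk kw quad_form_axis_axis d(1)
      using d(2) by (simp add: field_simps)
    then have "quad_form (A - outer v v) w w = quad_form A u u"
      by (simp add: quad_form_diff q)
    then show ?thesis using assms(1) by (simp add: psd_def)
  qed
  moreover have "(A - outer v v) $ i $ i = 0" if "A $ i $ i = 0" for i
    using psd_diag_zero[OF assms(1) that] that by (simp add: outer_def vA)
  moreover have "(A - outer v v) $ k $ k = 0"
    using d(2) by (simp add: outer_def vA d(1))
  ultimately show thesis by (intro that[of v]) (auto simp: psd_def)
qed

text \<open>A substitute for the spectral decomposition: each Schur complement step clears a nonzero
  diagonal entry and creates none, and once the diagonal is zero only the zero matrix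
  \<open>outer 0 0\<close> is left.\<close>

lemma psd_induct [consumes 1, case_names outer add]:
  fixes A :: "complex^'n^'n"
  assumes "psd A"
    and outer: "\<And>v. P (outer v v)"
    and add: "\<And>A B. P A \<Longrightarrow> P B \<Longrightarrow> P (A + B)"
  shows "P A"
  using assms(1)
proof (induction "card {i. A $ i $ i \<noteq> 0}" arbitrary: A rule: less_induct)
  case less
  show ?case
  proof (cases "\<exists>k. A $ k $ k \<noteq> 0")
    case True
    then obtain k where k: "A $ k $ k \<noteq> 0" by blast
    from psd_schur_complement[OF less.prems k] obtain v where
      v: "psd (A - outer v v)" "(A - outer v v) $ k $ k = 0"
      "\<And>i. A $ i $ i = 0 \<Longrightarrow> (A - outer v v) $ i $ i = 0" by metis
    have "{i. (A - outer v v) $ i $ i \<noteq> 0} \<subset> {i. A $ i $ i \<noteq> 0}" using v(2,3) k by blast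
    then have "P (A - outer v v)" by (intro less.hyps v(1) psubset_card_mono) auto
    from add[OF this outer[of v]] show ?thesis by simp
  next
    case False
    then have "A = outer 0 0"
      using psd_diag_zero[OF less.prems] by (simp add: vec_eq_iff outer_def)
    then show ?thesis using outer by metis
  qed
qed

section \<open>Tensor products and mixtures of channels\<close>

lemma linear_scaleR:
  fixes E :: "complex^'n^'n \<Rightarrow> complex^'m^'m"
  assumes "Vector_Spaces.linear cscale cscale E"
  shows "E (r *\<^sub>R X) = r *\<^sub>R E X"
proof -
  have s: "r *\<^sub>R Y = cscale (of_real r) Y" for Y :: "complex^'k^'k"
    by (simp add: cscale_def vec_eq_iff scaleR_conv_of_real[where 'a=complex])
  show ?thesis using assms by (simp add: s linear_cscale_iff)
qed

text \<open>Transport along an enumeration of \<open>I\<close>. The argument for tensor products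
  needs blocks indexed by pairs from \<open>{..<N} \<times> UNIV\<close>.\<close>

lemma completely_positive_finite_index:
  fixes E :: "complex^'n^'n \<Rightarrow> complex^'n^'n" and X :: "'i \<Rightarrow> 'i \<Rightarrow> complex^'n^'n"
  assumes "completely_positive E" and "finite I"
    and psd: "\<And>v. (\<Sum>k\<in>I. \<Sum>l\<in>I. quad_form (X k l) (v k) (v l)) \<in> \<real>\<^sub>\<ge>\<^sub>0"
  shows "(\<Sum>k\<in>I. \<Sum>l\<in>I. quad_form (E (X k l)) (v k) (v l)) \<in> \<real>\<^sub>\<ge>\<^sub>0"
proof -
  from ex_bij_betw_nat_finite[OF assms(2)] obtain h where h: "bij_betw h {..<card I} I"
    by (auto simp: atLeast0LessThan)
  define g where "g = inv_into {..<card I} h"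
  have gh: "g (h m) = m" if "m < card I" for m
    unfolding g_def using h that by (simp add: bij_betw_def)
  have *: "(\<Sum>k\<in>I. \<Sum>l\<in>I. f k l) = (\<Sum>k<card I. \<Sum>l<card I. f (h k) (h l))" for f :: "'i \<Rightarrow> 'i \<Rightarrow> complex"
    by (simp add: sum.reindex_bij_betw[OF h, symmetric])
  have "block_psd (card I) (\<lambda>k l. X (h k) (h l))"
    unfolding block_psd_def
  proof
    fix w :: "nat \<Rightarrow> complex^'n"
    have "(\<Sum>k<card I. \<Sum>l<card I. quad_form (X (h k) (h l)) (w k) (w l)) =
      (\<Sum>k\<in>I. \<Sum>l\<in>I. quad_form (X k l) (w (g k)) (w (g l)))"
      unfolding * by (intro sum.cong refl) (simp add: gh)
    then show "(\<Sum>k<card I. \<Sum>l<card I. quad_form (X (h k) (h l)) (w k) (w l)) \<in> \<real>\<^sub>\<ge>\<^sub>0"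
      using psd[of "\<lambda>k. w (g k)"] by simp
  qed
  then have "block_psd (card I) (\<lambda>k l. E (X (h k) (h l)))"
    using assms(1) by (simp add: completely_positive_def)
  then show ?thesis
    unfolding * by (simp add: block_psd_def)
qed

lemma channel_psd:
  assumes "channel E" and "psd X"
  shows "psd (E X)"
proof -
  have "(\<Sum>k\<in>{()}. \<Sum>l\<in>{()}. quad_form (E X) v v) \<in> \<real>\<^sub>\<ge>\<^sub>0" for v
    using completely_positive_finite_index[of E "{()}" "\<lambda>_ _. X" "\<lambda>_. v"] assms
    by (simp add: channel_def psd_def)
  then show ?thesis by (simp add: psd_def)
qed

text \<open>The factorization of \<open>E \<otimes> F\<close> into \<open>F\<close> on the second
  factor followed by \<open>E\<close> on the first, in coordinates.\<close>

lemma tensor_map_blocks: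
  fixes E :: "complex^'a^'a \<Rightarrow> complex^'a^'a" and F :: "complex^'b^'b \<Rightarrow> complex^'b^'b"
  assumes "Vector_Spaces.linear cscale cscale E" "Vector_Spaces.linear cscale cscale F"
  shows "tensor_map E F X $ (i, b) $ (j, b') =
    E (\<chi> i j. F (\<chi> b b'. X $ (i, b) $ (j, b')) $ b $ b') $ i $ j"
proof -
  have e: "E M $ i $ j = (\<Sum>k\<in>UNIV. \<Sum>l\<in>UNIV. M $ k $ l * E (matrix_unit k l) $ i $ j)" for M
    by (subst linear_sum_matrix_unit[OF assms(1), of M]) (simp add: sum_component cscale_def)
  have f: "F M $ b $ b' = (\<Sum>k\<in>UNIV. \<Sum>l\<in>UNIV. M $ k $ l * F (matrix_unit k l) $ b $ b')" for M
    by (subst linear_sum_matrix_unit[OF assms(2), of M]) (simp add: sum_component cscale_def)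
  have "tensor_map E F X $ (i, b) $ (j, b') =
    (\<Sum>k\<in>UNIV. \<Sum>c\<in>UNIV. \<Sum>l\<in>UNIV. \<Sum>c'\<in>UNIV. X $ (k, c) $ (l, c') *
      (E (matrix_unit k l) $ i $ j * F (matrix_unit c c') $ b $ b'))"
    by (simp add: tensor_map_def kron_def cscale_def sum_component
        UNIV_Times_UNIV[symmetric] sum.cartesian_product' del: UNIV_Times_UNIV)
  also have "\<dots> = (\<Sum>k\<in>UNIV. \<Sum>l\<in>UNIV. \<Sum>c\<in>UNIV. \<Sum>c'\<in>UNIV. X $ (k, c) $ (l, c') *
      (E (matrix_unit k l) $ i $ j * F (matrix_unit c c') $ b $ b'))"
    by (rule sum.cong[OF refl], rule sum.swap)
  also have "\<dots> = E (\<chi> i j. F (\<chi> b b'. X $ (i, b) $ (j, b')) $ b $ b') $ i $ j"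
    by (subst e[of "\<chi> i j. F (\<chi> b b'. X $ (i, b) $ (j, b')) $ b $ b'"]) (simp only: f[of "\<chi> b b'. X $ (i', b) $ (j', b')" for i' j'] vec_lambda_beta
        sum_distrib_left sum_distrib_right mult_ac)
  finally show ?thesis .
qed

text \<open>Both maps act blockwise once the other tensor factor is counted as part of the block
  index: first \<open>F\<close> with blocks over \<open>N \<times> 'a\<close>, then, after
  regrouping, \<open>E\<close> with blocks over \<open>N \<times> 'b\<close>.\<close>

lemma completely_positive_tensor_map:
  fixes E :: "complex^'a^'a \<Rightarrow> complex^'a^'a" and F :: "complex^'b^'b \<Rightarrow> complex^'b^'b"
  assumes "Vector_Spaces.linear cscale cscale E" "Vector_Spaces.linear cscale cscale F"
    and "completely_positive E" "completely_positive F"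
  shows "completely_positive (tensor_map E F)"
  unfolding completely_positive_def
proof (intro allI impI)
  fix N and X :: "nat \<Rightarrow> nat \<Rightarrow> complex^('a \<times> 'b)^('a \<times> 'b)"
  assume X: "block_psd N X"
  let ?Y = "\<lambda>k l i j. \<chi> b b'. X k l $ (i, b) $ (j, b')"
  let ?Z = "\<lambda>k l b b'. \<chi> i j. F (?Y k l i j) $ b $ b'"
  have split: "(\<Sum>p\<in>UNIV. f p) = (\<Sum>i\<in>UNIV. \<Sum>b\<in>UNIV. f (i, b))" for f :: "'a \<times> 'b \<Rightarrow> complex"
    by (simp add: UNIV_Times_UNIV[symmetric] sum.cartesian_product' del: UNIV_Times_UNIV)
  \<comment> \<open>The first tensor index joins the block index, which leaves matrices over
    \<open>'b\<close> for \<open>F\<close>.\<close>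
  have first: "(\<Sum>k<N. \<Sum>l<N. quad_form (W k l) (v k) (v l)) =
      (\<Sum>k\<in>{..<N} \<times> UNIV. \<Sum>l\<in>{..<N} \<times> UNIV.
        quad_form (\<chi> b b'. W (fst k) (fst l) $ (snd k, b) $ (snd l, b'))
          (\<chi> b. v (fst k) $ (snd k, b)) (\<chi> b. v (fst l) $ (snd l, b)))"
    for W :: "nat \<Rightarrow> nat \<Rightarrow> complex^('a \<times> 'b)^('a \<times> 'b)" and v
  proof -
    have "(\<Sum>k<N. \<Sum>l<N. quad_form (W k l) (v k) (v l)) =
      (\<Sum>k<N. \<Sum>l<N. \<Sum>i\<in>UNIV. \<Sum>b\<in>UNIV. \<Sum>j\<in>UNIV. \<Sum>b'\<in>UNIV.
         cnj (v k $ (i, b)) * W k l $ (i, b) $ (j, b') * v l $ (j, b'))"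
      by (simp only: quad_form_alt split)
    also have "\<dots> = (\<Sum>k<N. \<Sum>l<N. \<Sum>i\<in>UNIV. \<Sum>j\<in>UNIV. \<Sum>b\<in>UNIV. \<Sum>b'\<in>UNIV.
         cnj (v k $ (i, b)) * W k l $ (i, b) $ (j, b') * v l $ (j, b'))"
      by (rule sum.cong[OF refl], rule sum.cong[OF refl], rule sum.cong[OF refl], rule sum.swap)
    also have "\<dots> = (\<Sum>k<N. \<Sum>i\<in>UNIV. \<Sum>l<N. \<Sum>j\<in>UNIV. \<Sum>b\<in>UNIV. \<Sum>b'\<in>UNIV.
         cnj (v k $ (i, b)) * W k l $ (i, b) $ (j, b') * v l $ (j, b'))"
      by (rule sum.cong[OF refl], rule sum.swap)
    finally show ?thesis by (simp add: sum.cartesian_product' quad_form_alt)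
  qed
  \<comment> \<open>The second tensor index joins the block index, which leaves matrices over
    \<open>'a\<close> for \<open>E\<close>.\<close>
  have second: "(\<Sum>k<N. \<Sum>l<N. quad_form (W k l) (v k) (v l)) =
      (\<Sum>k\<in>{..<N} \<times> UNIV. \<Sum>l\<in>{..<N} \<times> UNIV.
        quad_form (\<chi> i j. W (fst k) (fst l) $ (i, snd k) $ (j, snd l))
          (\<chi> i. v (fst k) $ (i, snd k)) (\<chi> i. v (fst l) $ (i, snd l)))"
    for W :: "nat \<Rightarrow> nat \<Rightarrow> complex^('a \<times> 'b)^('a \<times> 'b)" and v
  proof -
    have "(\<Sum>k<N. \<Sum>l<N. quad_form (W k l) (v k) (v l)) =
      (\<Sum>k<N. \<Sum>l<N. \<Sum>i\<in>UNIV. \<Sum>b\<in>UNIV. \<Sum>j\<in>UNIV. \<Sum>b'\<in>UNIV.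
         cnj (v k $ (i, b)) * W k l $ (i, b) $ (j, b') * v l $ (j, b'))"
      by (simp only: quad_form_alt split)
    also have "\<dots> = (\<Sum>k<N. \<Sum>l<N. \<Sum>b\<in>UNIV. \<Sum>i\<in>UNIV. \<Sum>b'\<in>UNIV. \<Sum>j\<in>UNIV.
         cnj (v k $ (i, b)) * W k l $ (i, b) $ (j, b') * v l $ (j, b'))"
      by (rule sum.cong[OF refl], rule sum.cong[OF refl], subst sum.swap, rule sum.cong[OF refl],
          rule sum.cong[OF refl], rule sum.swap)
    also have "\<dots> = (\<Sum>k<N. \<Sum>l<N. \<Sum>b\<in>UNIV. \<Sum>b'\<in>UNIV. \<Sum>i\<in>UNIV. \<Sum>j\<in>UNIV.
         cnj (v k $ (i, b)) * W k l $ (i, b) $ (j, b') * v l $ (j, b'))"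
      by (rule sum.cong[OF refl], rule sum.cong[OF refl], rule sum.cong[OF refl], rule sum.swap)
    also have "\<dots> = (\<Sum>k<N. \<Sum>b\<in>UNIV. \<Sum>l<N. \<Sum>b'\<in>UNIV. \<Sum>i\<in>UNIV. \<Sum>j\<in>UNIV.
         cnj (v k $ (i, b)) * W k l $ (i, b) $ (j, b') * v l $ (j, b'))"
      by (rule sum.cong[OF refl], rule sum.swap)
    finally show ?thesis by (simp add: sum.cartesian_product' quad_form_alt)
  qed
  have Y: "(\<Sum>k\<in>{..<N} \<times> UNIV. \<Sum>l\<in>{..<N} \<times> UNIV.
      quad_form (?Y (fst k) (fst l) (snd k) (snd l)) (v k) (v l)) \<in> \<real>\<^sub>\<ge>\<^sub>0" for v
    using X[unfolded block_psd_def first, rule_format, of "\<lambda>k. \<chi> p. v (k, fst p) $ snd p"]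
    by simp
  note FY = completely_positive_finite_index[OF assms(4) _ Y]
  have "(\<Sum>k<N. \<Sum>l<N. quad_form (\<chi> p q. F (?Y k l (fst p) (fst q)) $ snd p $ snd q) (v k) (v l)) \<in> \<real>\<^sub>\<ge>\<^sub>0" for v
    unfolding first using FY by simp
  note Z0 = this[unfolded second]
  have Z: "(\<Sum>k\<in>{..<N} \<times> UNIV. \<Sum>l\<in>{..<N} \<times> UNIV.
      quad_form (?Z (fst k) (fst l) (snd k) (snd l)) (v k) (v l)) \<in> \<real>\<^sub>\<ge>\<^sub>0" for v
    using Z0[of "\<lambda>k. \<chi> p. v (k, snd p) $ fst p"] by simp
  note EZ = completely_positive_finite_index[OF assms(3) _ Z]
  show "block_psd N (\<lambda>k l. tensor_map E F (X k l))"
    unfolding block_psd_def second tensor_map_blocks[OF assms(1,2)] using EZ by simp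
qed

lemma trace_kron: "trace (kron A B) = trace A * trace B"
  by (simp add: trace_def kron_def sum_product UNIV_Times_UNIV[symmetric] sum.cartesian_product'
      del: UNIV_Times_UNIV)

lemma trace_cscale: "trace (cscale c A) = c * trace A"
  by (simp add: trace_def cscale_def sum_distrib_left)

lemma trace_sum: "trace (\<Sum>i\<in>I. f i) = (\<Sum>i\<in>I. trace (f i))"
  unfolding trace_def by (subst sum.swap) (simp add: sum_component)

lemma trace_matrix_unit: "trace (matrix_unit i j) = (if i = j then 1 else 0)"
  unfolding trace_def matrix_unit_def
  by (auto intro!: sum.neutral simp: if_distrib cong: if_cong)

lemma channel_tensor_map:
  assumes "channel E" "channel F"
  shows "channel (tensor_map E F)"
proof -
  have "trace (tensor_map E F X) = trace X" for X
  proof -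
    have "trace (tensor_map E F X) = (\<Sum>p\<in>UNIV. \<Sum>q\<in>UNIV. if p = q then X $ p $ q else 0)"
      using assms unfolding tensor_map_def trace_sum trace_cscale trace_kron
      by (intro sum.cong refl) (auto simp: channel_def trace_matrix_unit prod_eq_iff)
    then show ?thesis by (simp add: trace_def)
  qed
  then show ?thesis
    using assms by (simp add: channel_def linear_tensor_map completely_positive_tensor_map)
qed

lemma channel_mixture:
  assumes "channel E" "channel F" "0 \<le> \<mu>" "\<mu> \<le> 1"
  shows "channel (mixture \<mu> E F)"
proof -
  have "Vector_Spaces.linear cscale cscale (mixture \<mu> E F)"
    using assms(1,2) unfolding channel_def linear_cscale_iff mixture_def
    by (auto simp: cscale_def vec_eq_iff algebra_simps)
  moreover have "completely_positive (mixture \<mu> E F)"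
    unfolding completely_positive_def block_psd_def
  proof (intro allI impI)
    fix N v and X :: "nat \<Rightarrow> nat \<Rightarrow> complex^'a^'a"
    assume "\<forall>v. (\<Sum>k<N. \<Sum>l<N. quad_form (X k l) (v k) (v l)) \<in> \<real>\<^sub>\<ge>\<^sub>0"
    then have "(\<Sum>k<N. \<Sum>l<N. quad_form (E (X k l)) (v k) (v l)) \<in> \<real>\<^sub>\<ge>\<^sub>0"
      "(\<Sum>k<N. \<Sum>l<N. quad_form (F (X k l)) (v k) (v l)) \<in> \<real>\<^sub>\<ge>\<^sub>0"
      using assms(1,2) by (auto simp: channel_def completely_positive_def block_psd_def)
    then have "of_real \<mu> * (\<Sum>k<N. \<Sum>l<N. quad_form (E (X k l)) (v k) (v l)) +
      of_real (1 - \<mu>) * (\<Sum>k<N. \<Sum>l<N. quad_form (F (X k l)) (v k) (v l)) \<in> \<real>\<^sub>\<ge>\<^sub>0"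
      using assms(3,4) by (intro nonneg_Reals_add_I nonneg_Reals_scaleR) auto
    then show "(\<Sum>k<N. \<Sum>l<N. quad_form (mixture \<mu> E F (X k l)) (v k) (v l)) \<in> \<real>\<^sub>\<ge>\<^sub>0"
      by (simp only: mixture_def quad_form_add quad_form_scaleR sum.distrib sum_distrib_left)
  qed
  moreover have "trace (mixture \<mu> E F X) = trace X" for X
  proof -
    have "trace (mixture \<mu> E F X) = of_real \<mu> * trace (E X) + of_real (1 - \<mu>) * trace (F X)"
      by (simp add: mixture_def trace_def sum.distrib sum_distrib_left scaleR_conv_of_real[where 'a=complex])
    then show ?thesis using assms(1,2) by (simp add: channel_def algebra_simps)
  qed
  ultimately show ?thesis by (simp add: channel_def)
qed

section \<open>Pauli operators and the Schmidt decomposition\<close>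

definition cdot :: "complex^'n \<Rightarrow> complex^'n \<Rightarrow> complex" where
  "cdot u v = (\<Sum>i\<in>UNIV. cnj (u $ i) * v $ i)"

definition orthonormal :: "complex^2 \<Rightarrow> complex^2 \<Rightarrow> bool" where
  "orthonormal x y \<longleftrightarrow> cdot x x = 1 \<and> cdot y y = 1 \<and> cdot x y = 0"

definition tensor_vec :: "complex^'a \<Rightarrow> complex^'b \<Rightarrow> complex^('a \<times> 'b)" where
  "tensor_vec x y = (\<chi> p. x $ fst p * y $ snd p)"

definition pauli_x :: "complex^2 \<Rightarrow> complex^2 \<Rightarrow> complex^2^2" where
  "pauli_x x y = outer x y + outer y x"

definition pauli_y :: "complex^2 \<Rightarrow> complex^2 \<Rightarrow> complex^2^2" where
  "pauli_y x y = cscale (- \<i>) (outer x y) + cscale \<i> (outer y x)"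

definition pauli_z :: "complex^2 \<Rightarrow> complex^2 \<Rightarrow> complex^2^2" where
  "pauli_z x y = outer x x - outer y y"

lemma cdot_self: "cdot v v = of_real ((norm v)\<^sup>2)"
proof -
  have "(norm v)\<^sup>2 = (\<Sum>i\<in>UNIV. (cmod (v $ i))\<^sup>2)"
    by (simp add: norm_vec_def L2_set_def sum_nonneg)
  then show ?thesis
    by (simp add: cdot_def mult.commute flip: complex_norm_square)
qed

lemma cdot_commute: "cdot v u = cnj (cdot u v)"
  by (simp add: cdot_def mult.commute)

lemma orthonormal_sym: "orthonormal x y \<Longrightarrow> orthonormal y x"
  unfolding orthonormal_def by (metis cdot_commute complex_cnj_zero)

text \<open>Orthonormality says that the matrix with the conjugates of \<open>x\<close>,
  \<open>y\<close> as rows is a left inverse of the one with columns \<open>x\<close>,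
  \<open>y\<close>; completeness says that it is a right inverse.\<close>

lemma orthonormal_complete:
  assumes "orthonormal x y"
  shows "outer x x + outer y y = mat 1"
proof -
  let ?U = "(\<chi> i j. if j = 1 then x $ i else y $ i) :: complex^2^2"
  let ?V = "(\<chi> i j. if i = 1 then cnj (x $ j) else cnj (y $ j)) :: complex^2^2"
  have "cdot y x = 0" using assms by (metis cdot_commute complex_cnj_zero orthonormal_def)
  then have "?V ** ?U = (mat 1 :: complex^2^2)"
    using assms by (simp add: vec_eq_iff forall_2 matrix_matrix_mult_def mat_def sum_2 orthonormal_def cdot_def)
  then have "?U ** ?V = (mat 1 :: complex^2^2)"
    by (simp only: matrix_left_right_inverse)
  moreover have "?U ** ?V = outer x x + outer y y"
    by (simp add: vec_eq_iff matrix_matrix_mult_def sum_2 outer_def)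
  ultimately show ?thesis by simp
qed

lemma trace_outer: "trace (outer u v) = cdot v u"
  by (simp add: trace_def outer_def cdot_def mult.commute)

lemma kron_add_left: "kron (A + B) C = kron A C + kron B C"
  and kron_add_right: "kron A (B' + C) = kron A B' + kron A C"
  and kron_scaleR_left: "kron (r *\<^sub>R A) C = r *\<^sub>R kron A C"
  and kron_scaleR_right: "kron A (r *\<^sub>R C) = r *\<^sub>R kron A C"
  by (simp_all add: kron_def vec_eq_iff algebra_simps)

text \<open>The six operators are left free so that one expression covers a pure input, built from
  Pauli operators, and its image under \<open>tensor_map E E\<close>.\<close>

definition schmidt_form :: "real \<Rightarrow> real \<Rightarrow> real \<Rightarrow> complex^2^2 \<Rightarrow> complex^2^2 \<Rightarrow> complex^2^2 \<Rightarrow>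
    complex^2^2 \<Rightarrow> complex^2^2 \<Rightarrow> complex^2^2 \<Rightarrow> complex^(2 \<times> 2)^(2 \<times> 2)" where
  "schmidt_form n c s X Y Z X' Y' Z' = (1/4) *\<^sub>R
     (n *\<^sub>R kron (mat 1) (mat 1) + c *\<^sub>R (kron Z (mat 1) + kron (mat 1) Z') +
      n *\<^sub>R kron Z Z' + s *\<^sub>R (kron X X' - kron Y Y'))"

lemma outer_schmidt_form:
  assumes "orthonormal x x'" "orthonormal y y'"
    and \<psi>: "\<psi> = a *\<^sub>R tensor_vec x y + b *\<^sub>R tensor_vec x' y'"
  shows "outer \<psi> \<psi> = schmidt_form (a\<^sup>2 + b\<^sup>2) (a\<^sup>2 - b\<^sup>2) (2 * a * b)
    (pauli_x x x') (pauli_y x x') (pauli_z x x') (pauli_x y y') (pauli_y y y') (pauli_z y y')"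
proof -
  have alg: "(a * (x * y) + b * (x' * y')) * (a * (X * Y) + b * (X' * Y')) = (1/4) *
      ((a\<^sup>2 + b\<^sup>2) * ((x * X + x' * X') * (y * Y + y' * Y')) +
       (a\<^sup>2 - b\<^sup>2) * ((x * X - x' * X') * (y * Y + y' * Y') + (x * X + x' * X') * (y * Y - y' * Y')) +
       (a\<^sup>2 + b\<^sup>2) * ((x * X - x' * X') * (y * Y - y' * Y')) +
       (2 * a * b) * ((x * X' + x' * X) * (y * Y' + y' * Y)
         - (- \<i> * (x * X') + \<i> * (x' * X)) * (- \<i> * (y * Y') + \<i> * (y' * Y))))"
    (is "_ = ?R") for a b x y x' y' X Y X' Y' :: complex
  proof -
    \<comment> \<open>The terms with \<open>mat 1\<close> and \<open>pauli_z\<close> yield the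
      contributions in \<open>a\<^sup>2\<close> and \<open>b\<^sup>2\<close> (\<open>pq\<close>),
      those with \<open>pauli_x\<close> and \<open>pauli_y\<close> the cross terms in
      \<open>a * b\<close> (\<open>rt\<close>).\<close>
    have pq: "(a\<^sup>2 + b\<^sup>2) * ((p + p') * (q + q')) +
        (a\<^sup>2 - b\<^sup>2) * ((p - p') * (q + q') + (p + p') * (q - q')) +
        (a\<^sup>2 + b\<^sup>2) * ((p - p') * (q - q')) = 4 * (a\<^sup>2 * (p * q) + b\<^sup>2 * (p' * q'))" for p p' q q'
      by algebra
    have rt: "(r + r') * (t + t') - (- \<i> * r + \<i> * r') * (- \<i> * t + \<i> * t') = 2 * (r * t + r' * t')"
      for r r' t t'
      by (simp add: algebra_simps)
    have "(a * (x * y) + b * (x' * y')) * (a * (X * Y) + b * (X' * Y')) =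
      (1/4) * (4 * (a\<^sup>2 * ((x * X) * (y * Y)) + b\<^sup>2 * ((x' * X') * (y' * Y'))) +
       (2 * a * b) * (2 * ((x * X') * (y * Y') + (x' * X) * (y' * Y))))"
      by (simp add: power2_eq_square field_simps)
    then show ?thesis by (simp only: pq rt)
  qed
  have I: "mat 1 $ i $ j = z $ i * cnj (z $ j) + z' $ i * cnj (z' $ j)"
    if "orthonormal z z'" for z z' :: "complex^2" and i j
    by (simp only: orthonormal_complete[OF that, symmetric] outer_def vector_add_component vec_lambda_beta)
  show ?thesis
    unfolding schmidt_form_def vec_eq_iff
  proof (intro allI)
    fix p q :: "2 \<times> 2"
    show "outer \<psi> \<psi> $ p $ q = ((1/4) *\<^sub>R
      ((a\<^sup>2 + b\<^sup>2) *\<^sub>R kron (mat 1) (mat 1) + (a\<^sup>2 - b\<^sup>2) *\<^sub>R (kron (pauli_z x x') (mat 1) + kron (mat 1) (pauli_z y y')) +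
       (a\<^sup>2 + b\<^sup>2) *\<^sub>R kron (pauli_z x x') (pauli_z y y') +
       (2 * a * b) *\<^sub>R (kron (pauli_x x x') (pauli_x y y') - kron (pauli_y x x') (pauli_y y y')))) $ p $ q"
      unfolding \<psi>
      using alg[of "of_real a" "x $ fst p" "y $ snd p" "of_real b" "x' $ fst p" "y' $ snd p"
          "cnj (x $ fst q)" "cnj (y $ snd q)" "cnj (x' $ fst q)" "cnj (y' $ snd q)"]
      by (simp only: outer_def kron_def pauli_x_def pauli_y_def pauli_z_def cscale_def tensor_vec_def vec_lambda_beta
          vector_add_component vector_minus_component vector_scaleR_component scaleR_conv_of_real[where 'a=complex]
          complex_cnj_add complex_cnj_mult complex_cnj_complex_of_real I[OF assms(1), of "fst p"] I[OF assms(2), of "snd p"]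
          of_real_add of_real_diff of_real_mult of_real_power of_real_divide of_real_numeral of_real_1)
  qed
qed

section \<open>Existence of Schmidt bases\<close>

lemma complex_quadratic_root:
  fixes A B C :: complex
  assumes "A \<noteq> 0"
  obtains t where "A * t\<^sup>2 + B * t + C = 0"
proof -
  define d where "d = csqrt (B\<^sup>2 - 4 * A * C)"
  define t where "t = (d - B) / (2 * A)"
  have "2 * A * t + B = d" using assms by (simp add: t_def)
  moreover have "d\<^sup>2 = B\<^sup>2 - 4 * A * C" by (simp add: d_def)
  moreover have "4 * A * (A * t\<^sup>2 + B * t + C) = (2 * A * t + B)\<^sup>2 - (B\<^sup>2 - 4 * A * C)"
    by (simp add: power2_eq_square algebra_simps)
  ultimately have "4 * A * (A * t\<^sup>2 + B * t + C) = 0" by simp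
  then show thesis using assms that by simp
qed

text \<open>Supplies the singular vectors of the matrix with columns \<open>m\<close>,
  \<open>m'\<close>. For \<open>y\<close>, \<open>y'\<close> proportional to \<open>(1, t)\<close>
  and \<open>(- cnj t, 1)\<close>, orthogonality of the images of the conjugated basis is a
  quadratic equation in \<open>t\<close>; when its leading coefficient vanishes,
  \<open>t = 0\<close> solves it.\<close>

lemma orthonormal_orthogonal_images:
  fixes m m' :: "complex^2"
  obtains y y' where "orthonormal y y'"
    "cdot (\<chi> i. m $ i * cnj (y $ 1) + m' $ i * cnj (y $ 2)) (\<chi> i. m $ i * cnj (y' $ 1) + m' $ i * cnj (y' $ 2)) = 0"
proof -
  obtain t where t: "cnj (cdot m m') * t\<^sup>2 + (cdot m m - cdot m' m') * t + (- cdot m m') = 0"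
  proof (cases "cdot m m' = 0")
    case True then show ?thesis using that[of 0] by simp
  next
    case False then show ?thesis using complex_quadratic_root that by (metis complex_cnj_zero_iff)
  qed
  define N where "N = sqrt (1 + (cmod t)\<^sup>2)"
  have N: "N > 0" "N\<^sup>2 = 1 + (cmod t)\<^sup>2" by (simp_all add: N_def add_pos_nonneg)
  have NN: "complex_of_real N * complex_of_real N = 1 + t * cnj t"
    using N(2) by (simp flip: of_real_mult complex_norm_square add: power2_eq_square)
  have Nc: "complex_of_real N \<noteq> 0" using N(1) by simp
  have Nt: "1 + t * cnj t \<noteq> 0" using NN Nc by (metis mult_eq_0_iff)
  define y where "y = (\<chi> i::2. (if i = 1 then 1 else t) / of_real N)"
  define y' where "y' = (\<chi> i::2. (if i = 1 then - cnj t else 1) / of_real N)"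
  have "orthonormal y y'"
    using Nt by (simp add: orthonormal_def cdot_def sum_2 y_def y'_def NN flip: add_divide_distrib)
  moreover have "cdot (\<chi> i. m $ i * cnj (y $ 1) + m' $ i * cnj (y $ 2)) (\<chi> i. m $ i * cnj (y' $ 1) + m' $ i * cnj (y' $ 2))
    = - (cnj (cdot m m') * t\<^sup>2 + (cdot m m - cdot m' m') * t + (- cdot m m')) / (of_real N * of_real N)"
    using Nc by (simp add: cdot_def sum_2 y_def y'_def field_simps power2_eq_square)
  ultimately show thesis using that[of y y'] t by simp
qed

lemma unit_vector_decomposition:
  fixes w :: "complex^2"
  obtains x a where "cdot x x = 1" "0 \<le> a" "w = a *\<^sub>R x"
proof (cases "w = 0")
  case True
  show ?thesis
    by (rule that[of "axis 1 1" 0]) (simp_all add: True cdot_self)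
next
  case False
  then show ?thesis
    by (intro that[of "(1 / norm w) *\<^sub>R w" "norm w"]) (simp_all add: cdot_self)
qed

lemma orthonormal_extend:
  fixes x w :: "complex^2"
  assumes "cdot x x = 1" "cdot x w = 0"
  obtains y b where "orthonormal x y" "0 \<le> b" "w = b *\<^sub>R y"
proof (cases "w = 0")
  case True
  define y where "y = (\<chi> i::2. if i = 1 then - cnj (x $ 2) else cnj (x $ 1))"
  have "orthonormal x y"
    using assms(1) by (simp add: orthonormal_def cdot_def sum_2 y_def algebra_simps)
  then show ?thesis using that[of y 0] True by simp
next
  case False
  have "cdot x ((1 / norm w) *\<^sub>R w) = of_real (1 / norm w) * cdot x w"
    by (simp add: cdot_def sum_2 scaleR_conv_of_real[where 'a=complex] algebra_simps)
  then show ?thesis using assms False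
    by (intro that[of "(1 / norm w) *\<^sub>R w" "norm w"]) (simp_all add: orthonormal_def cdot_self[of "_ *\<^sub>R _"])
qed

text \<open>A zero vector has no direction of its own, so when \<open>w\<close> vanishes the basis
  is completed from the direction of \<open>w'\<close>.\<close>

lemma orthogonal_pair_decomposition:
  fixes w w' :: "complex^2"
  assumes "cdot w w' = 0"
  obtains x x' a b where "orthonormal x x'" "0 \<le> a" "0 \<le> b" "w = a *\<^sub>R x" "w' = b *\<^sub>R x'"
proof -
  obtain x a where x: "cdot x x = 1" "0 \<le> a" "w = a *\<^sub>R x"
    by (rule unit_vector_decomposition)
  show thesis
  proof (cases "a = 0")
    case False
    have "cdot w w' = of_real a * cdot x w'"
      by (simp add: x(3) cdot_def sum_2 scaleR_conv_of_real[where 'a=complex] algebra_simps)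
    then have "cdot x w' = 0" using assms False by simp
    from orthonormal_extend[OF x(1) this] show thesis using that x(2,3) by metis
  next
    case True
    obtain x' b where x': "cdot x' x' = 1" "0 \<le> b" "w' = b *\<^sub>R x'"
      by (rule unit_vector_decomposition)
    have "cdot x' 0 = 0" by (simp add: cdot_def)
    from orthonormal_extend[OF x'(1) this] obtain x2 where "orthonormal x' x2" by metis
    then show thesis using that[of x2 x' 0 b] orthonormal_sym x' x(3) True by auto
  qed
qed

text \<open>Contracting the second factor of \<open>\<psi>\<close> with the conjugates of a suitable
  basis \<open>y\<close>, \<open>y'\<close> gives two orthogonal vectors, \<open>a x\<close> and
  \<open>b x'\<close>; completeness of \<open>y\<close>, \<open>y'\<close> reassembles
  \<open>\<psi>\<close>.\<close>

lemma schmidt_decomposition: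
  fixes \<psi> :: "complex^(2 \<times> 2)"
  obtains x x' y y' a b where "orthonormal x x'" "orthonormal y y'" "0 \<le> a" "0 \<le> b"
    "\<psi> = a *\<^sub>R tensor_vec x y + b *\<^sub>R tensor_vec x' y'"
proof -
  obtain y y' where y: "orthonormal y y'" and
    o: "cdot (\<chi> i. (\<chi> i. \<psi> $ (i, 1)) $ i * cnj (y $ 1) + (\<chi> i. \<psi> $ (i, 2)) $ i * cnj (y $ 2))
      (\<chi> i. (\<chi> i. \<psi> $ (i, 1)) $ i * cnj (y' $ 1) + (\<chi> i. \<psi> $ (i, 2)) $ i * cnj (y' $ 2)) = 0"
    by (rule orthonormal_orthogonal_images)
  obtain x x' a b where x: "orthonormal x x'" "0 \<le> a" "0 \<le> b" and
    w: "(\<chi> i. (\<chi> i. \<psi> $ (i, 1)) $ i * cnj (y $ 1) + (\<chi> i. \<psi> $ (i, 2)) $ i * cnj (y $ 2)) = a *\<^sub>R x"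
     "(\<chi> i. (\<chi> i. \<psi> $ (i, 1)) $ i * cnj (y' $ 1) + (\<chi> i. \<psi> $ (i, 2)) $ i * cnj (y' $ 2)) = b *\<^sub>R x'"
    by (rule orthogonal_pair_decomposition[OF o])
  have "\<psi> $ (i, j) = (a *\<^sub>R tensor_vec x y + b *\<^sub>R tensor_vec x' y') $ (i, j)" for i j
  proof -
    have I: "y $ k * cnj (y $ j) + y' $ k * cnj (y' $ j) = (if k = j then 1 else 0)" for k j
      using arg_cong[OF orthonormal_complete[OF y], of "\<lambda>A. A $ k $ j"] by (simp add: outer_def mat_def)
    have ax: "a *\<^sub>R x $ i = \<psi> $ (i, 1) * cnj (y $ 1) + \<psi> $ (i, 2) * cnj (y $ 2)"
      "b *\<^sub>R x' $ i = \<psi> $ (i, 1) * cnj (y' $ 1) + \<psi> $ (i, 2) * cnj (y' $ 2)"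
      using arg_cong[OF w(1), of "\<lambda>v. v $ i"] arg_cong[OF w(2), of "\<lambda>v. v $ i"] by simp_all
    have "(a *\<^sub>R tensor_vec x y + b *\<^sub>R tensor_vec x' y') $ (i, j) = (a *\<^sub>R x $ i) * y $ j + (b *\<^sub>R x' $ i) * y' $ j"
      by (simp add: tensor_vec_def)
    also have "\<dots> = \<psi> $ (i, 1) * (y $ j * cnj (y $ 1) + y' $ j * cnj (y' $ 1)) + \<psi> $ (i, 2) * (y $ j * cnj (y $ 2) + y' $ j * cnj (y' $ 2))"
      unfolding ax by (simp add: algebra_simps)
    also have "\<dots> = \<psi> $ (i, j)" unfolding I using exhaust_2[of j] by auto
    finally show ?thesis by simp
  qed
  then have "\<psi> = a *\<^sub>R tensor_vec x y + b *\<^sub>R tensor_vec x' y'"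
    by (simp add: vec_eq_iff)
  with x y show thesis using that by blast
qed

section \<open>Separability of the output\<close>

text \<open>The real span of the Pauli operators. On it \<open>norm\<close>, the Hilbert-Schmidt
  norm, is \<open>sqrt 2\<close> times the Bloch length.\<close>

definition traceless_hermitian :: "complex^2^2 \<Rightarrow> bool" where
  "traceless_hermitian H \<longleftrightarrow> trace H = 0 \<and> (\<forall>i j. H $ j $ i = cnj (H $ i $ j))"

lemma trace_scaleR: "trace (r *\<^sub>R (A :: complex^'n^'n)) = of_real r * trace A"
  by (simp add: trace_def scaleR_conv_of_real[where 'a=complex] sum_distrib_left)

lemma traceless_hermitian_scaleR: "traceless_hermitian H \<Longrightarrow> traceless_hermitian (r *\<^sub>R H)"
  unfolding traceless_hermitian_def trace_scaleR by (metis complex_cnj_scaleR mult_zero_right vector_scaleR_component)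

lemma traceless_hermitianD:
  assumes "traceless_hermitian H"
  shows "trace H = 0" "cnj (H $ i $ j) = H $ j $ i"
  using assms unfolding traceless_hermitian_def by metis+

lemma norm_matrix_square: "(norm (H :: complex^'n^'m))\<^sup>2 = (\<Sum>i\<in>UNIV. \<Sum>j\<in>UNIV. (cmod (H $ i $ j))\<^sup>2)"
  by (simp add: norm_vec_def L2_set_def sum_nonneg)

text \<open>With diagonal entries \<open>1 + h\<close>, \<open>1 - h\<close> and off-diagonal entry
  \<open>z\<close>, the norm bound gives \<open>|z|^2 \<le> (1 + h) (1 - h)\<close>, so the
  arithmetic-geometric mean inequality lets the diagonal terms of the form absorb the cross
  term.\<close>

lemma psd_one_plus:
  assumes H: "traceless_hermitian H" and n: "(norm H)\<^sup>2 \<le> 2"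
  shows "psd (mat 1 + H)"
  unfolding psd_def
proof
  fix v :: "complex^2"
  define h z where "h = Re (H $ 1 $ 1)" and "z = H $ 1 $ 2"
  have H21: "H $ 2 $ 1 = cnj z" and "H $ 1 $ 1 = cnj (H $ 1 $ 1)"
    using traceless_hermitianD(2)[OF H] by (simp_all add: z_def)
  then have H11: "H $ 1 $ 1 = of_real h" by (simp add: h_def complex_eq_iff)
  have H22: "H $ 2 $ 2 = - of_real h"
    using traceless_hermitianD(1)[OF H] H11 by (simp add: trace_def sum_2 eq_neg_iff_add_eq_0 add.commute)
  have hz: "h\<^sup>2 + (cmod z)\<^sup>2 \<le> 1"
    using n by (simp add: norm_matrix_square sum_2 H11 H22 H21 z_def[symmetric])
  have q: "quad_form (mat 1 + H) v v = of_real ((1 + h) * (cmod (v $ 1))\<^sup>2 + (1 - h) * (cmod (v $ 2))\<^sup>2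
      + 2 * Re (cnj (v $ 1) * z * v $ 2))"
  proof -
    have "quad_form (mat 1 + H) v v = (1 + of_real h) * (v $ 1 * cnj (v $ 1)) + (1 - of_real h) * (v $ 2 * cnj (v $ 2))
      + (cnj (v $ 1) * z * v $ 2 + cnj (cnj (v $ 1) * z * v $ 2))"
      by (simp add: quad_form_alt sum_2 mat_def H11 H22 H21 z_def[symmetric] algebra_simps)
    then show ?thesis
      by (simp only: complex_add_cnj complex_norm_square[symmetric] of_real_add of_real_mult of_real_diff of_real_1)
  qed
  have "\<bar>h\<bar> \<le> 1" using hz by (metis abs_square_le_1 add_increasing2 dual_order.trans le_add_same_cancel1 zero_le_power2)
  then have h: "1 + h \<ge> 0" "1 - h \<ge> 0" by auto
  have "cmod (cnj (v $ 1) * z * v $ 2) = cmod (v $ 1) * cmod z * cmod (v $ 2)"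
    by (simp add: norm_mult)
  then have re: "- Re (cnj (v $ 1) * z * v $ 2) \<le> cmod (v $ 1) * cmod z * cmod (v $ 2)"
    by (metis abs_Re_le_cmod abs_le_D2)
  have "2 * (cmod (v $ 1) * cmod z * cmod (v $ 2)) \<le> (1 + h) * (cmod (v $ 1))\<^sup>2 + (1 - h) * (cmod (v $ 2))\<^sup>2"
  proof (rule power2_le_imp_le)
    let ?p = "(1 + h) * (cmod (v $ 1))\<^sup>2" and ?q = "(1 - h) * (cmod (v $ 2))\<^sup>2"
    have "(2 * (cmod (v $ 1) * cmod z * cmod (v $ 2)))\<^sup>2 = 4 * ((cmod (v $ 1))\<^sup>2 * (cmod (v $ 2))\<^sup>2) * (cmod z)\<^sup>2"
      by (simp add: power_mult_distrib)
    also have "\<dots> \<le> 4 * ((cmod (v $ 1))\<^sup>2 * (cmod (v $ 2))\<^sup>2) * (1 - h\<^sup>2)"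
      using hz by (intro mult_left_mono) auto
    also have "\<dots> = 4 * ?p * ?q" by (simp add: algebra_simps power2_eq_square)
    also have "\<dots> \<le> (?p + ?q)\<^sup>2" using sum_squares_bound[of ?p ?q] unfolding power2_sum by linarith
    finally show "(2 * (cmod (v $ 1) * cmod z * cmod (v $ 2)))\<^sup>2 \<le> (?p + ?q)\<^sup>2" .
  qed (use h in auto)
  then show "quad_form (mat 1 + H) v v \<in> \<real>\<^sub>\<ge>\<^sub>0"
    unfolding q nonneg_Reals_of_real_iff using re by linarith
qed

text \<open>For a traceless Hermitian \<open>H\<close> of norm \<open>sqrt 2\<close>, the signs
  \<open>r = 1\<close> and \<open>r = -1\<close> give the two eigenprojections of
  \<open>H\<close>.\<close>

definition bloch_state :: "complex^2^2 \<Rightarrow> real \<Rightarrow> complex^2^2" where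
  "bloch_state H r = (1/2) *\<^sub>R (mat 1 + r *\<^sub>R H)"

lemma state_bloch_state:
  assumes "traceless_hermitian H" "(norm H)\<^sup>2 \<le> 2" "r \<in> {-1, 1}"
  shows "state (bloch_state H r)"
proof -
  have "psd (mat 1 + r *\<^sub>R H)"
    using assms by (intro psd_one_plus traceless_hermitian_scaleR) auto
  moreover have "trace (mat 1 + r *\<^sub>R H) = 2"
    using assms(1) trace_scaleR[of r H] by (simp add: trace_add traceless_hermitianD(1) trace_I)
  ultimately show ?thesis
    unfolding state_def bloch_state_def by (simp add: psd_scaleR trace_scaleR)
qed

abbreviation product_states :: "(complex^('a::finite \<times> 'b::finite)^('a \<times> 'b)) set" where
  "product_states \<equiv> {kron A B | A B. state A \<and> state B}"

text \<open>The cone admits unnormalized decompositions. Product states have trace one, so the trace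
  of \<open>\<rho>\<close> forces the scale factor to be one.\<close>

lemma separable_cone:
  fixes \<rho> :: "complex^('a::finite \<times> 'b::finite)^('a \<times> 'b)"
  assumes "\<rho> \<in> convex_cone hull product_states" and "trace \<rho> = 1"
  shows "separable \<rho>"
proof -
  \<comment> \<open>The cone over the empty set contains only zero, whose trace is not one.\<close>
  have ne: "product_states \<noteq> ({} :: (complex^('a \<times> 'b)^('a \<times> 'b)) set)"
    using assms by (intro notI) (simp add: trace_def)
  obtain \<sigma> c where \<sigma>: "\<sigma> \<in> convex hull product_states" "\<rho> = c *\<^sub>R \<sigma>"
    using assms(1) unfolding convex_cone_hull_separate_nonempty[OF ne] conic_hull_explicit by auto
  have "convex hull product_states \<subseteq> {\<sigma> :: complex^('a \<times> 'b)^('a \<times> 'b). trace \<sigma> = 1}"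
  proof (rule hull_minimal)
    show "convex {\<sigma> :: complex^('a \<times> 'b)^('a \<times> 'b). trace \<sigma> = 1}"
      unfolding convex_def
      by (auto simp: trace_add trace_scaleR simp flip: of_real_add)
  qed (auto simp: trace_kron state_def)
  then have "trace \<sigma> = 1" using \<sigma>(1) by auto
  then have "of_real c = (1::complex)" using assms(2) \<sigma>(2) by (simp add: trace_scaleR)
  then show ?thesis using \<sigma> by (simp add: separable_def)
qed

lemma convex_cone_hull_sum:
  assumes "\<And>i. i \<in> I \<Longrightarrow> f i \<in> convex_cone hull S"
  shows "sum f I \<in> convex_cone hull S"
  using assms
  by (induction I rule: infinite_finite_induct)
    (auto intro: convex_cone_hull_add convex_cone_hull_contains_0)

lemma kron_bloch_state:
  "kron (bloch_state H r) (bloch_state K t) = (1/4) *\<^sub>R (kron (mat 1) (mat 1) +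
    r *\<^sub>R kron H (mat 1) + t *\<^sub>R kron (mat 1) K + (r * t) *\<^sub>R kron H K)"
  by (simp add: bloch_state_def kron_add_left kron_add_right kron_scaleR_left kron_scaleR_right
      algebra_simps)

text \<open>With \<open>u = \<plusminus>u\<^sub>3\<close> and \<open>v = \<plusminus>v\<^sub>3\<close> this is the nonnegativity of the four weights of the
  part of the decomposition built from the third Pauli directions. It is the Cauchy--Schwarz inequality
  for \<open>(c, s)\<close> and \<open>(u + v, - p)\<close>, since \<open>(u + v)\<^sup>2 + (1 - u\<^sup>2) (1 - v\<^sup>2) = (1 + u v)\<^sup>2\<close>.\<close>

lemma weight_nonneg:
  fixes n c s p u v :: real
  assumes "n \<ge> 0" "c\<^sup>2 + s\<^sup>2 = n\<^sup>2" "p\<^sup>2 \<le> (1 - u\<^sup>2) * (1 - v\<^sup>2)" "\<bar>u\<bar> \<le> 1" "\<bar>v\<bar> \<le> 1"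
  shows "0 \<le> n - s * p + c * (u + v) + n * (u * v)"
proof -
  have "\<bar>u * v\<bar> \<le> 1" using assms(4,5) by (simp add: abs_mult mult_le_one)
  then have uv: "0 \<le> 1 + u * v" by linarith
  have "s * p - c * (u + v) \<le> n * (1 + u * v)"
  proof (rule power2_le_imp_le)
    have "(s * p - c * (u + v))\<^sup>2 \<le> (c\<^sup>2 + s\<^sup>2) * ((u + v)\<^sup>2 + p\<^sup>2)"
    proof -
      have "(c\<^sup>2 + s\<^sup>2) * ((u + v)\<^sup>2 + p\<^sup>2) - (s * p - c * (u + v))\<^sup>2 = (c * p + s * (u + v))\<^sup>2"
        by (simp add: power2_eq_square algebra_simps)
      then show ?thesis using zero_le_power2[of "c * p + s * (u + v)"] by linarith
    qed
    also have "\<dots> \<le> n\<^sup>2 * ((u + v)\<^sup>2 + (1 - u\<^sup>2) * (1 - v\<^sup>2))"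
      unfolding assms(2) using assms(3) by (intro mult_left_mono) auto
    also have "\<dots> = (n * (1 + u * v))\<^sup>2"
      by (simp add: power2_eq_square algebra_simps)
    finally show "(s * p - c * (u + v))\<^sup>2 \<le> (n * (1 + u * v))\<^sup>2" .
  qed (use assms(1) uv in simp)
  then show ?thesis by (simp add: algebra_simps)
qed

text \<open>Equal signs in the first sum leave \<open>I \<otimes> I + X \<otimes> X'\<close>,
  opposite signs in the second leave \<open>I \<otimes> I - Y \<otimes> Y'\<close>. The last sum
  deducts the surplus identity and expands the rest over the four sign pairs.\<close>

lemma schmidt_form_scaled_decomposition:
  "schmidt_form n c s (u1 *\<^sub>R X) (u2 *\<^sub>R Y) (u3 *\<^sub>R Z) (v1 *\<^sub>R X') (v2 *\<^sub>R Y') (v3 *\<^sub>R Z') =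
    (\<Sum>r\<in>{-1, 1}. (s * (u1 * v1) / 2) *\<^sub>R kron (bloch_state X r) (bloch_state X' r)) +
    (\<Sum>r\<in>{-1, 1}. (s * (u2 * v2) / 2) *\<^sub>R kron (bloch_state Y r) (bloch_state Y' (- r))) +
    (\<Sum>r\<in>{-1, 1}. \<Sum>t\<in>{-1, 1}.
      ((n - s * (u1 * v1 + u2 * v2) + c * (r * u3 + t * v3) + n * (r * u3 * (t * v3))) / 4) *\<^sub>R
      kron (bloch_state Z r) (bloch_state Z' t))"
  unfolding kron_bloch_state
  by (simp add: schmidt_form_def kron_scaleR_left kron_scaleR_right vec_eq_iff
      scaleR_conv_of_real[where 'a=complex] field_simps)

lemma schmidt_form_cone:
  assumes n: "n \<ge> 0" and s: "s \<ge> 0" and ncs: "c\<^sup>2 + s\<^sup>2 = n\<^sup>2"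
    and th: "traceless_hermitian X" "traceless_hermitian Y" "traceless_hermitian Z"
      "traceless_hermitian X'" "traceless_hermitian Y'" "traceless_hermitian Z'"
    and norms: "(norm X)\<^sup>2 + (norm Y)\<^sup>2 + (norm Z)\<^sup>2 \<le> 2"
      "(norm X')\<^sup>2 + (norm Y')\<^sup>2 + (norm Z')\<^sup>2 \<le> 2"
  shows "schmidt_form n c s X Y Z X' Y' Z' \<in> convex_cone hull product_states"
proof -
  \<comment> \<open>\<open>u H\<close> is the Bloch length and \<open>w H\<close> the normalized
    operator. For \<open>H = 0\<close> division by zero makes \<open>w H\<close> zero, so
    \<open>uw\<close> still holds and \<open>wn\<close> is only an inequality.\<close>
  define u where "u H = norm H / sqrt 2" for H :: "complex^2^2"
  define w where "w H = (1 / u H) *\<^sub>R H" for H :: "complex^2^2"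
  have u0: "u H \<ge> 0" for H by (simp add: u_def)
  have uw: "H = u H *\<^sub>R w H" for H by (simp add: w_def u_def)
  have wn: "(norm (w H))\<^sup>2 \<le> 2" for H
    by (simp add: w_def u_def power_divide)
  have wt: "traceless_hermitian (w H)" if "traceless_hermitian H" for H
    unfolding w_def using that by (rule traceless_hermitian_scaleR)
  have st: "state (bloch_state (w H) r)" if "traceless_hermitian H" "r \<in> {-1, 1}" for H r
    using wt[OF that(1)] wn that(2) by (rule state_bloch_state)
  have pr: "a *\<^sub>R kron (bloch_state (w H) r) (bloch_state (w K) t) \<in> convex_cone hull product_states"
    if "traceless_hermitian H" "traceless_hermitian K" "r \<in> {-1, 1}" "t \<in> {-1, 1}" "0 \<le> a" for H K r t a
    using st[OF that(1,3)] st[OF that(2,4)] that(5)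
    by (intro convex_cone_hull_mul hull_inc) auto
  have un: "(u X)\<^sup>2 + (u Y)\<^sup>2 + (u Z)\<^sup>2 \<le> 1" "(u X')\<^sup>2 + (u Y')\<^sup>2 + (u Z')\<^sup>2 \<le> 1"
    using norms by (auto simp: u_def power_divide)
  \<comment> \<open>Cauchy-Schwarz, by Lagrange's identity, combines the two norm bounds into the
    bound on \<open>p\<close> in \<open>weight_nonneg\<close>.\<close>
  have "(u X * u X' + u Y * u Y')\<^sup>2 \<le> ((u X)\<^sup>2 + (u Y)\<^sup>2) * ((u X')\<^sup>2 + (u Y')\<^sup>2)"
  proof -
    have "((u X)\<^sup>2 + (u Y)\<^sup>2) * ((u X')\<^sup>2 + (u Y')\<^sup>2) - (u X * u X' + u Y * u Y')\<^sup>2 = (u X * u Y' - u Y * u X')\<^sup>2"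
      by (simp add: power2_eq_square algebra_simps)
    then show ?thesis using zero_le_power2[of "u X * u Y' - u Y * u X'"] by linarith
  qed
  also have "\<dots> \<le> (1 - (u Z)\<^sup>2) * (1 - (u Z')\<^sup>2)"
  proof (intro mult_mono)
    have "0 \<le> (u X)\<^sup>2 + (u Y)\<^sup>2" by simp
    then show "0 \<le> 1 - (u Z)\<^sup>2" using un(1) by linarith
  qed (use un in auto)
  finally have p: "(u X * u X' + u Y * u Y')\<^sup>2 \<le> (1 - (u Z)\<^sup>2) * (1 - (u Z')\<^sup>2)" .
  have "(u Z)\<^sup>2 \<le> 1" "(u Z')\<^sup>2 \<le> 1"
    using un zero_le_power2[of "u X"] zero_le_power2[of "u Y"] zero_le_power2[of "u X'"] zero_le_power2[of "u Y'"]
    by linarith+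
  then have ab: "\<bar>u Z\<bar> \<le> 1" "\<bar>u Z'\<bar> \<le> 1" by (simp_all add: abs_square_le_1)
  \<comment> \<open>The signs are absorbed into the lengths: \<open>u = r * u Z\<close> and
    \<open>v = t * u Z'\<close>.\<close>
  have weight: "0 \<le> n - s * (u X * u X' + u Y * u Y') + c * (r * u Z + t * u Z') + n * (r * u Z * (t * u Z'))"
    if "r \<in> {-1, 1}" "t \<in> {-1, 1}" for r t
    using that p ab by (intro weight_nonneg n ncs) (auto simp: power_mult_distrib abs_mult)
  have "schmidt_form n c s (u X *\<^sub>R w X) (u Y *\<^sub>R w Y) (u Z *\<^sub>R w Z)
      (u X' *\<^sub>R w X') (u Y' *\<^sub>R w Y') (u Z' *\<^sub>R w Z') \<in> convex_cone hull product_states"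
    unfolding schmidt_form_scaled_decomposition
    by (intro convex_cone_hull_add convex_cone_hull_sum pr th divide_nonneg_pos weight mult_nonneg_nonneg s u0) auto
  then show ?thesis by (simp flip: uw)
qed

text \<open>Each Pauli operator is \<open>outer z z - mat 1\<close>, with \<open>z\<close> a
  multiple by \<open>sqrt 2\<close> of a unit eigenvector for eigenvalue one. The image of
  \<open>outer z z\<close> is positive, hence Hermitian, and \<open>mat 1\<close> is fixed.\<close>

lemma unital_channel_pauli:
  assumes "channel E" "unital E" "orthonormal x y"
  shows "traceless_hermitian (E (pauli_x x y))"
    and "traceless_hermitian (E (pauli_y x y))"
    and "traceless_hermitian (E (pauli_z x y))"
proof -
  have lin: "E (A + B) = E A + E B" for A B
    using assms(1) by (simp add: channel_def linear_cscale_iff)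
  have tr: "trace (E A) = trace A" for A
    using assms(1) by (simp add: channel_def)
  have *: "traceless_hermitian (E (outer z z - mat 1))" if "trace (outer z z - mat 1 :: complex^2^2) = 0" for z
  proof -
    have "E (outer z z) = E (outer z z - mat 1) + mat 1"
      using lin[of "outer z z - mat 1" "mat 1"] assms(2) by (simp add: unital_def)
    then have "E (outer z z - mat 1) = E (outer z z) - mat 1" by simp
    moreover have "(E (outer z z) - mat 1) $ j $ i = cnj ((E (outer z z) - mat 1) $ i $ j)" for i j
    proof -
      have "E (outer z z) $ j $ i = cnj (E (outer z z) $ i $ j)"
        by (rule psd_hermitian[OF channel_psd[OF assms(1) psd_outer]])
      moreover have "mat 1 $ j $ i = cnj ((mat 1 :: complex^2^2) $ i $ j)"
        by (simp add: mat_def)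
      ultimately show ?thesis by (simp only: vector_minus_component complex_cnj_diff)
    qed
    ultimately show ?thesis
      unfolding traceless_hermitian_def using tr[of "outer z z - mat 1"] that by metis
  qed
  have I: "mat 1 = outer x x + outer y y" using orthonormal_complete[OF assms(3)] by simp
  have yx: "cdot y x = 0" using orthonormal_sym[OF assms(3)] by (simp add: orthonormal_def)
  have on: "cdot x x = 1" "cdot y y = 1" "cdot x y = 0" using assms(3) by (auto simp: orthonormal_def)
  have x: "pauli_x x y = outer (x + y) (x + y) - mat 1"
    by (simp add: I pauli_x_def outer_def vec_eq_iff algebra_simps)
  have y: "pauli_y x y = outer (x + \<i> *s y) (x + \<i> *s y) - mat 1"
    by (simp add: I pauli_y_def outer_def cscale_def vec_eq_iff algebra_simps)
  have "outer (sqrt 2 *\<^sub>R x) (sqrt 2 *\<^sub>R x) = (sqrt 2 * sqrt 2) *\<^sub>R outer x x"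
    by (simp add: outer_def vec_eq_iff)
  then have z: "pauli_z x y = outer (sqrt 2 *\<^sub>R x) (sqrt 2 *\<^sub>R x) - mat 1"
    by (simp add: I pauli_z_def scaleR_2)
  have "trace (pauli_x x y) = 0" by (simp add: pauli_x_def trace_add trace_outer yx on)
  then show "traceless_hermitian (E (pauli_x x y))" unfolding x by (rule *)
  have "trace (pauli_y x y) = 0" by (simp add: pauli_y_def trace_add trace_cscale trace_outer yx on)
  then show "traceless_hermitian (E (pauli_y x y))" unfolding y by (rule *)
  have "trace (pauli_z x y) = 0" by (simp add: pauli_z_def trace_sub trace_outer on)
  then show "traceless_hermitian (E (pauli_z x y))" unfolding z by (rule *)
qed

text \<open>Unitality keeps the \<open>mat 1\<close> factors in place, so the coefficients
  \<open>n\<close>, \<open>c\<close>, \<open>s\<close> survive.\<close>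

lemma tensor_map_schmidt_form:
  assumes "channel E" "unital E"
  shows "tensor_map E E (schmidt_form n c s X Y Z X' Y' Z') =
    schmidt_form n c s (E X) (E Y) (E Z) (E X') (E Y') (E Z')"
proof -
  let ?T = "tensor_map E E"
  have add: "?T (A + B) = ?T A + ?T B" for A B
    using linear_tensor_map[of E E] by (simp add: linear_cscale_iff)
  have diff: "?T (A - B) = ?T A - ?T B" for A B
    using add[of "A - B" B] by (simp add: algebra_simps)
  have kron: "?T (kron A B) = kron (E A) (E B)" for A B
    using assms(1) by (simp add: tensor_map_kron channel_def)
  show ?thesis
    using assms(2)
    by (simp add: schmidt_form_def add diff kron linear_scaleR[OF linear_tensor_map] unital_def)
qed

section \<open>The criterion and its convexity\<close>

text \<open>For \<open>A = outer v v\<close> the trace is the quadratic form of \<open>B\<close> at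
  \<open>v\<close>; additivity does the rest.\<close>

lemma trace_mult_psd_nonneg:
  assumes "psd A" "psd B"
  shows "0 \<le> Re (trace (A ** B))"
  using assms(1)
proof (induction A rule: psd_induct)
  case (outer v)
  have "trace (outer v v ** B) = quad_form B v v"
    unfolding trace_def matrix_matrix_mult_def outer_def quad_form_alt vec_lambda_beta
    by (subst sum.swap) (simp add: mult_ac)
  then show ?case using assms(2) by (simp add: psd_def complex_nonneg_Reals_iff)
next
  case (add A B')
  then show ?case by (simp add: matrix_matrix_mult_def trace_def algebra_simps sum.distrib)
qed

text \<open>The real part of the trace of \<open>M\<close> times the swap of the two factors; it is
  real-linear, so its nonnegativity defines a convex set.\<close>

definition swap_trace :: "complex^('a::finite \<times> 'a)^('a \<times> 'a) \<Rightarrow> real" where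
  "swap_trace M = Re (\<Sum>i\<in>UNIV. \<Sum>j\<in>UNIV. M $ (i, j) $ (j, i))"

lemma swap_trace_add: "swap_trace (A + B) = swap_trace A + swap_trace B"
  and swap_trace_diff: "swap_trace (A - B) = swap_trace A - swap_trace B"
  and swap_trace_scaleR: "swap_trace (r *\<^sub>R A) = r * swap_trace A"
  by (simp_all add: swap_trace_def sum.distrib sum_subtractf sum_distrib_left)

lemma swap_trace_kron: "swap_trace (kron A B) = Re (trace (A ** B))"
  by (simp add: swap_trace_def kron_def trace_def matrix_matrix_mult_def)

text \<open>On \<open>kron A B\<close> the swap expectation is the trace of the product of
  \<open>A\<close> and \<open>B\<close>, nonnegative for states, and a half-space containing all
  product states contains their hull.\<close>

lemma swap_trace_separable:
  assumes "separable \<rho>"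
  shows "0 \<le> swap_trace \<rho>"
proof -
  have "convex hull product_states \<subseteq> {\<rho>. 0 \<le> swap_trace \<rho>}"
  proof (rule hull_minimal)
    show "convex {\<rho>. 0 \<le> swap_trace \<rho>}"
      by (auto simp: convex_def swap_trace_add swap_trace_scaleR)
  qed (auto simp: swap_trace_kron state_def trace_mult_psd_nonneg)
  then show ?thesis using assms by (auto simp: separable_def)
qed

lemma swap_trace_hermitian_square:
  assumes "traceless_hermitian H"
  shows "swap_trace (kron H H) = (norm H)\<^sup>2"
proof -
  have "trace (H ** H) = (\<Sum>i\<in>UNIV. \<Sum>j\<in>UNIV. H $ i $ j * cnj (H $ i $ j))"
    by (simp add: trace_def matrix_matrix_mult_def traceless_hermitianD(2)[OF assms])
  then show ?thesis
    by (simp add: swap_trace_kron norm_matrix_square flip: complex_norm_square)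
qed

text \<open>The test state is the singlet: its image has swap expectation \<open>(2 - \<Sum>\<parallel>E \<sigma>\<^sub>i\<parallel>\<^sup>2) / 4\<close>,
  which cannot be negative for a separable state.\<close>

lemma two_LEA_pauli_norms:
  assumes E: "two_LEA E" "unital E" and on: "orthonormal x y"
  shows "(norm (E (pauli_x x y)))\<^sup>2 + (norm (E (pauli_y x y)))\<^sup>2 + (norm (E (pauli_z x y)))\<^sup>2 \<le> 2"
proof -
  have ch: "channel E" using E(1) by (simp add: two_LEA_def)
  \<comment> \<open>The singlet, with its minus sign moved into the second basis \<open>y\<close>,
    \<open>- x\<close> so that it is in Schmidt form.\<close>
  define \<psi> where "\<psi> = sqrt (1/2) *\<^sub>R tensor_vec x y + sqrt (1/2) *\<^sub>R tensor_vec y (- x)"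
  have on': "orthonormal y (- x)"
    using orthonormal_sym[OF on] by (simp add: orthonormal_def cdot_def sum_negf)
  \<comment> \<open>Reversing X and Z but not Y makes all three correlation terms of the Schmidt
    form negative.\<close>
  have p: "pauli_x y (- x) = - pauli_x x y" "pauli_y y (- x) = pauli_y x y"
    "pauli_z y (- x) = - pauli_z x y"
    by (simp_all add: pauli_x_def pauli_y_def pauli_z_def outer_def cscale_def vec_eq_iff)
  have "2 * sqrt (1/2) * sqrt (1/2) = (1::real)"
    unfolding mult.assoc by simp
  then have \<psi>: "outer \<psi> \<psi> = schmidt_form 1 0 1 (pauli_x x y) (pauli_y x y) (pauli_z x y)
      (- pauli_x x y) (pauli_y x y) (- pauli_z x y)"
    using outer_schmidt_form[OF on on' \<psi>_def] by (simp only: p) simp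
  have neg: "E (- A) = - E A" for A
    using linear_scaleR[of E "-1" A] ch by (simp add: channel_def)
  have kneg: "kron A (- B) = - kron A B" for A B :: "complex^2^2"
    using kron_scaleR_right[of A "-1" B] by simp
  have swneg: "swap_trace (- A) = - swap_trace A" for A :: "complex^(2 \<times> 2)^(2 \<times> 2)"
    using swap_trace_scaleR[of "-1" A] by simp
  have tr0: "trace (pauli_x x y) = 0" "trace (pauli_y x y) = 0" "trace (pauli_z x y) = 0"
    using on orthonormal_sym[OF on]
    by (simp_all add: pauli_x_def pauli_y_def pauli_z_def trace_add trace_sub trace_cscale trace_outer orthonormal_def)
  have trneg: "trace (- A) = - trace A" for A :: "complex^(2 \<times> 2)^(2 \<times> 2)"
    using trace_scaleR[of "-1" A] by simp
  have "trace (outer \<psi> \<psi>) = 1"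
    by (simp add: \<psi> schmidt_form_def trace_add trace_sub trace_scaleR trace_kron tr0 trace_I kneg trneg)
  then have "state (outer \<psi> \<psi>)" by (simp add: state_def psd_outer)
  then have "0 \<le> swap_trace (tensor_map E E (outer \<psi> \<psi>))"
    using E(1) by (simp add: two_LEA_def entanglement_annihilating_def swap_trace_separable)
  also have "swap_trace (tensor_map E E (outer \<psi> \<psi>)) = (1/4) *
      (2 - ((norm (E (pauli_x x y)))\<^sup>2 + (norm (E (pauli_y x y)))\<^sup>2 + (norm (E (pauli_z x y)))\<^sup>2))"
    unfolding \<psi> tensor_map_schmidt_form[OF ch E(2)] neg
    by (simp add: schmidt_form_def kneg swap_trace_add swap_trace_diff swneg swap_trace_scaleR
        swap_trace_hermitian_square unital_channel_pauli[OF ch E(2) on])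
      (simp add: swap_trace_kron trace_I)
  finally show ?thesis by simp
qed

text \<open>Aiming at the cone lets \<open>\<psi>\<close> have any norm, so
  \<open>psd_induct\<close> reduces all positive inputs to Schmidt forms;
  \<open>separable_cone\<close> restores the normalization.\<close>

lemma two_LEA_if_pauli_norms:
  assumes ch: "channel E" and un: "unital E"
    and norms: "\<And>x y. orthonormal x y \<Longrightarrow>
      (norm (E (pauli_x x y)))\<^sup>2 + (norm (E (pauli_y x y)))\<^sup>2 + (norm (E (pauli_z x y)))\<^sup>2 \<le> 2"
  shows "two_LEA E"
proof -
  have chT: "channel (tensor_map E E)" by (rule channel_tensor_map[OF ch ch])
  have cone: "tensor_map E E \<rho> \<in> convex_cone hull product_states" if "psd \<rho>" for \<rho>
    using that
  proof (induction \<rho> rule: psd_induct)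
    case (outer \<psi>)
    obtain x x' y y' a b where s: "orthonormal x x'" "orthonormal y y'" "0 \<le> a" "0 \<le> b"
      "\<psi> = a *\<^sub>R tensor_vec x y + b *\<^sub>R tensor_vec x' y'"
      by (rule schmidt_decomposition)
    have "(a\<^sup>2 - b\<^sup>2)\<^sup>2 + (2 * a * b)\<^sup>2 = (a\<^sup>2 + b\<^sup>2)\<^sup>2"
      by algebra
    then show ?case
      unfolding outer_schmidt_form[OF s(1,2,5)] tensor_map_schmidt_form[OF ch un]
      using s(3,4)
      by (intro schmidt_form_cone unital_channel_pauli[OF ch un] norms s(1,2)) auto
  next
    case (add A B)
    then show ?case
      using linear_tensor_map[of E E] by (simp add: linear_cscale_iff convex_cone_hull_add)
  qed
  have "separable (tensor_map E E \<rho>)" if "state \<rho>" for \<rho>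
    using that chT by (intro separable_cone cone) (auto simp: state_def channel_def)
  then show ?thesis
    using ch chT by (simp add: two_LEA_def entanglement_annihilating_def)
qed

text \<open>The sum of squares is the squared norm of a triple in the product space, where balls are
  convex.\<close>

lemma convex_norm_triple_bound:
  fixes A B C A' B' C' :: "'a::real_normed_vector"
  assumes "(norm A)\<^sup>2 + (norm B)\<^sup>2 + (norm C)\<^sup>2 \<le> d" "(norm A')\<^sup>2 + (norm B')\<^sup>2 + (norm C')\<^sup>2 \<le> d"
    and "\<mu> \<in> {0..1}"
  shows "(norm (\<mu> *\<^sub>R A + (1 - \<mu>) *\<^sub>R A'))\<^sup>2 + (norm (\<mu> *\<^sub>R B + (1 - \<mu>) *\<^sub>R B'))\<^sup>2 +
    (norm (\<mu> *\<^sub>R C + (1 - \<mu>) *\<^sub>R C'))\<^sup>2 \<le> d"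
proof -
  have *: "norm (X, Y, Z) \<le> sqrt d \<longleftrightarrow> (norm X)\<^sup>2 + (norm Y)\<^sup>2 + (norm Z)\<^sup>2 \<le> d" for X Y Z :: 'a
    by (simp add: norm_Pair add.assoc)
  have "(A, B, C) \<in> cball 0 (sqrt d)" "(A', B', C') \<in> cball 0 (sqrt d)"
    using assms(1,2) by (simp_all add: *)
  then have "\<mu> *\<^sub>R (A, B, C) + (1 - \<mu>) *\<^sub>R (A', B', C') \<in> cball 0 (sqrt d)"
    using assms(3) by (intro convexD convex_cball) auto
  then show ?thesis by (simp add: *)
qed

theorem proposition3:
  fixes E\<^sub>1 E\<^sub>2 :: "complex^2^2 \<Rightarrow> complex^2^2" and \<mu> :: real
  assumes "channel E\<^sub>1" and "unital E\<^sub>1" and "two_LEA E\<^sub>1"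
    and "channel E\<^sub>2" and "unital E\<^sub>2" and "two_LEA E\<^sub>2"
    and "\<mu> \<in> {0..1}"
  shows "channel (mixture \<mu> E\<^sub>1 E\<^sub>2) \<and> unital (mixture \<mu> E\<^sub>1 E\<^sub>2) \<and> two_LEA (mixture \<mu> E\<^sub>1 E\<^sub>2)"
proof -
  have ch: "channel (mixture \<mu> E\<^sub>1 E\<^sub>2)"
    using assms by (intro channel_mixture) auto
  have un: "unital (mixture \<mu> E\<^sub>1 E\<^sub>2)"
    using assms(2,5) by (simp add: unital_def mixture_def flip: scaleR_left_distrib)
  \<comment> \<open>In each fixed basis, necessity gives the bound for both channels, and the
    mixture sends every Pauli operator to the convex combination of its two images.\<close>
  have "two_LEA (mixture \<mu> E\<^sub>1 E\<^sub>2)"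
    using assms two_LEA_pauli_norms
    by (intro two_LEA_if_pauli_norms ch un) (simp add: mixture_def convex_norm_triple_bound)
  with ch un show ?thesis by blast
qed

end
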